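(* Let $z$ be an indeterminate. For every $n\ge1$, in $\mathbb{Q}(z)$, $$\sum_{F\in F(n)}\prod_{h\in\mathcal{H}(F)}\frac{(h-1)!}{h\,(h-2+z)_{h-2}}=z\,(n+z-1)_{n-1},$$ where $(x)_m=x(x-1)\cdots(x-m+1)$ is the falling factorial.
   Context: $F(n)$ is the set of labeled forests on $\{1,\dots,n\}$, i.e. sets of rooted labeled trees (children unordered) whose vertex sets partition $\{1,\dots,n\}$. For a vertex $u$ of $F$, the hook length $h_u$ is the number of descendants of $u$ (counting $u$ itself), and $\mathcal{H}(F)$ is the multiset of hook lengths of all vertices; the product is over all vertices. Falling factorial: $(x)_m=x(x-1)\cdots(x-m+1)$ for $m\ge1$, $(x)_0=1$, and $(x)_{-1}=1/(x+1)$ (so for $h=1$, $(z-1)_{-1}=1/z$). *)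

theory Defs
  imports
    "HOL-Library.FSet"
    "HOL-Library.Multiset"
    "HOL-Library.Disjoint_Sets"
    "HOL-Computational_Algebra.Polynomial"
    "HOL-Computational_Algebra.Fraction_Field"
begin

text \<open>
  Rooted trees with unordered children.  Nothing in the type prevents a label from
  occurring twice, and identical siblings are identified; the predicate \<open>labeled_tree\<close>
  below requires distinct labels, so that vertices can be identified with their labels.
\<close>

datatype (verts: 'a) rtree = Node (root: 'a) (children: "'a rtree fset")

inductive labeled_tree :: "'a rtree \<Rightarrow> bool" where
  "(\<And>t. t |\<in>| ts \<Longrightarrow> labeled_tree t) \<Longrightarrow>
   disjoint_family_on verts (fset ts) \<Longrightarrow>
   (\<And>t. t |\<in>| ts \<Longrightarrow> a \<notin> verts t) \<Longrightarrow>
   labeled_tree (Node a ts)"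

definition labeled_forests :: "'a set \<Rightarrow> 'a rtree set set" where
  "labeled_forests A =
     {F. (\<forall>t\<in>F. labeled_tree t) \<and> disjoint_family_on verts F \<and> (\<Union>t\<in>F. verts t) = A}"

text \<open>Sums over \<open>labeled_forests {1..n}\<close> are genuine finite sums.\<close>

lemma finite_labeled_forests:
  assumes "finite A"
  shows "finite (labeled_forests A)"
  using assms
proof (induction A rule: finite_psubset_induct)
  case (psubset A)
  define T where "T = (\<Union>a\<in>A. \<Union>B\<in>{B. B \<subset> A}. (\<lambda>F. Node a (Abs_fset F)) ` labeled_forests B)"
  have "finite T"
    unfolding T_def using psubset by (auto intro: finite_subset[of _ "Pow A"])
  have "labeled_forests A \<subseteq> Pow T"
  proof (intro subsetI PowI)
    fix F t
    assume F: "F \<in> labeled_forests A" and t: "t \<in> F"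
    have lt: "labeled_tree t" and sub: "verts t \<subseteq> A"
      using F t by (auto simp: labeled_forests_def)
    from lt obtain a ts where eq: "t = Node a ts"
      and ts: "\<And>s. s |\<in>| ts \<Longrightarrow> labeled_tree s" "disjoint_family_on verts (fset ts)"
      and a: "\<And>s. s |\<in>| ts \<Longrightarrow> a \<notin> verts s"
      by (cases rule: labeled_tree.cases) auto
    define B where "B = (\<Union>s\<in>fset ts. verts s)"
    have "a \<in> A" "B \<subset> A"
      using sub a by (auto simp: eq B_def)
    moreover have "fset ts \<in> labeled_forests B"
      using ts by (auto simp: labeled_forests_def B_def)
    ultimately show "t \<in> T"
      unfolding T_def eq by (auto intro!: bexI[of _ a] exI[of _ B] image_eqI[of _ _ "fset ts"]
        simp: fset_inverse)
  qed
  with \<open>finite T\<close> show ?case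
    by (meson finite_Pow_iff finite_subset)
qed

text \<open>The subtrees rooted at the vertices of a tree, including the tree itself.\<close>

primrec subtrees :: "'a rtree \<Rightarrow> 'a rtree set" where
  "subtrees (Node a ts) = insert (Node a ts) (\<Union> (fset (subtrees |`| ts)))"

text \<open>The descendants of a vertex include the vertex itself.\<close>

definition descendants :: "'a rtree set \<Rightarrow> 'a \<Rightarrow> 'a set" where
  "descendants F u = (\<Union>s \<in> {s \<in> (\<Union>t\<in>F. subtrees t). root s = u}. verts s)"

definition hook_length :: "'a rtree set \<Rightarrow> 'a \<Rightarrow> nat" where
  "hook_length F u = card (descendants F u)"

definition hook_lengths :: "'a rtree set \<Rightarrow> nat multiset" where
  "hook_lengths F = image_mset (hook_length F) (mset_set (\<Union>t\<in>F. verts t))"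

text \<open>
  The falling factorial \<open>(x)\<^sub>m\<close>, meaningful for \<open>m \<ge> - 1\<close> only, with the convention
  \<open>(x)\<^sub>-\<^sub>1 = 1 / (x + 1)\<close>.
\<close>

definition falling_fact :: "'a::field \<Rightarrow> int \<Rightarrow> 'a" where
  "falling_fact x m = (if m = - 1 then 1 / (x + 1) else (\<Prod>i<nat m. x - of_nat i))"

text \<open>The indeterminate of \<open>\<rat>(z)\<close>, the fraction field of \<open>\<rat>[z]\<close>.\<close>

definition ratfun_z :: "rat poly fract" where
  "ratfun_z = Fract [:0, 1:] 1"

end

theory Submission
  imports Defs
begin

text \<open>
  The weight \<open>w h\<close> of a hook length satisfies \<open>w h * h * z(z+1)\<dots>(z+h-2) = z * (h-1)!\<close>.  If
  forests on \<open>m < k\<close> vertices have total weight \<open>z(z+1)\<dots>(z+m-1)\<close>, then removing the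
  root shows that trees on \<open>k\<close> vertices have total weight \<open>z * (k-1)!\<close>.  Splitting a forest into the
  tree containing a fixed vertex and the rest turns this into a convolution of the rising
  factorials of \<open>z\<close> and \<open>1\<close>, which Vandermonde's identity evaluates.
\<close>

section \<open>Descendants and hook lengths under union and under attaching a root\<close>

lemma root_in_verts: "root t \<in> verts t"
  by (cases t) auto

lemma verts_subtrees: "s \<in> subtrees t \<Longrightarrow> verts s \<subseteq> verts t"
proof (induction t arbitrary: s)
  case (Node a ts)
  then show ?case by fastforce
qed

lemma descendants_Un: "descendants (F \<union> G) u = descendants F u \<union> descendants G u"
  by (auto simp: descendants_def)

lemma descendants_eq_empty:
  assumes "u \<notin> (\<Union>t\<in>F. verts t)"
  shows "descendants F u = {}"
  using assms verts_subtrees root_in_verts by (fastforce simp: descendants_def)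

text \<open>The only subtree of \<open>Node a ts\<close> that is not already a subtree of a child is
  the whole tree, and its root is a.\<close>

lemma descendants_Node:
  "descendants {Node a ts} u = (if u = a then verts (Node a ts) else {}) \<union> descendants (fset ts) u"
proof -
  have "{s \<in> (\<Union>t\<in>{Node a ts}. subtrees t). root s = u} =
      (if u = a then {Node a ts} else {}) \<union> {s \<in> (\<Union>t\<in>fset ts. subtrees t). root s = u}"
    by auto
  then show ?thesis
    unfolding descendants_def by (simp only: UN_Un) (simp split: if_split)
qed

text \<open>A vertex of one forest has no descendants in the other when the vertex sets are
  disjoint, so neither forest affects the hook lengths of the other. Finiteness is there for
  \<open>mset_set\<close>.\<close>

lemma hook_lengths_Un:
  assumes fin: "finite (\<Union>t\<in>F \<union> G. verts t)"
    and disj: "(\<Union>t\<in>F. verts t) \<inter> (\<Union>t\<in>G. verts t) = {}"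
  shows "hook_lengths (F \<union> G) = hook_lengths F + hook_lengths G"
proof -
  let ?V = "\<lambda>F. \<Union>t\<in>F. verts t"
  have F: "hook_length (F \<union> G) u = hook_length F u" if "u \<in> ?V F" for u
  proof -
    have "u \<notin> ?V G" using that disj by blast
    then show ?thesis
      by (simp add: hook_length_def descendants_Un descendants_eq_empty)
  qed
  have G: "hook_length (F \<union> G) u = hook_length G u" if "u \<in> ?V G" for u
  proof -
    have "u \<notin> ?V F" using that disj by blast
    then show ?thesis
      by (simp add: hook_length_def descendants_Un descendants_eq_empty)
  qed
  have fins: "finite (?V F)" "finite (?V G)"
    using fin by (auto simp: UN_Un)
  have "mset_set (?V (F \<union> G)) = mset_set (?V F) + mset_set (?V G)"
    using fins disj by (simp only: UN_Un mset_set_Union)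
  then show ?thesis
    unfolding hook_lengths_def using F G fins
    by (auto intro!: arg_cong2[of _ _ _ _ "(+)"] image_mset_cong)
qed

text \<open>Every vertex below the root keeps its descendants. Since a does not occur below, it is a
  new vertex, and all vertices of the tree descend from it.\<close>

lemma hook_lengths_Node:
  assumes fin: "finite (\<Union>t\<in>fset ts. verts t)" and a: "a \<notin> (\<Union>t\<in>fset ts. verts t)"
  shows "hook_lengths {Node a ts} = add_mset (card (verts (Node a ts))) (hook_lengths (fset ts))"
proof -
  let ?V = "\<Union>t\<in>fset ts. verts t"
  have "hook_length {Node a ts} a = card (verts (Node a ts))"
    using descendants_eq_empty[OF a] by (simp add: hook_length_def descendants_Node)
  moreover have "hook_length {Node a ts} u = hook_length (fset ts) u" if "u \<in> ?V" for u
    using that a by (auto simp: hook_length_def descendants_Node)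
  ultimately show ?thesis
    unfolding hook_lengths_def using fin a
    by (auto intro!: image_mset_cong)
qed

section \<open>Root removal for trees, and splitting off one tree of a forest\<close>

definition labeled_trees :: "'a set \<Rightarrow> 'a rtree set" where
  "labeled_trees A = {t. labeled_tree t \<and> verts t = A}"

text \<open>The inductive conditions on the children are exactly those of a labeled forest, which
  ties trees and forests together in a mutual recursion.\<close>

lemma labeled_tree_Node_iff:
  "labeled_tree (Node a ts) \<longleftrightarrow>
     fset ts \<in> labeled_forests (\<Union>t\<in>fset ts. verts t) \<and> a \<notin> (\<Union>t\<in>fset ts. verts t)"
  by (subst labeled_tree.simps) (auto simp: labeled_forests_def)

text \<open>The vertex sets of the trees are nonempty and disjoint, so \<open>verts\<close> is
  injective on F, with values in the finite set \<open>Pow A\<close>. Finiteness guarantees that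
  \<open>Abs_fset F\<close> really has the elements of F.\<close>

lemma finite_labeled_forest:
  assumes "finite A" "F \<in> labeled_forests A"
  shows "finite F"
proof (rule inj_on_finite[where f = verts and B = "Pow A"])
  show "inj_on verts F"
  proof (rule inj_onI)
    fix s t assume st: "s \<in> F" "t \<in> F" "verts s = verts t"
    then have "root s \<in> verts s \<inter> verts t"
      using root_in_verts[of s] by simp
    moreover have "disjoint_family_on verts F"
      using assms(2) by (simp add: labeled_forests_def)
    ultimately show "s = t"
      using st unfolding disjoint_family_on_def by blast
  qed
qed (use assms in \<open>auto simp: labeled_forests_def\<close>)

lemma bij_betw_labeled_trees:
  assumes "finite A"
  shows "bij_betw (\<lambda>(a, F). Node a (Abs_fset F)) (SIGMA a:A. labeled_forests (A - {a})) (labeled_trees A)"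
proof (rule bij_betw_byWitness[where f' = "\<lambda>t. (root t, fset (children t))"])
  have inv: "fset (Abs_fset F) = F" if "F \<in> labeled_forests (A - {a})" for a F
    using finite_labeled_forest[OF _ that] assms by (simp add: Abs_fset_inverse)
  then show "\<forall>x\<in>SIGMA a:A. labeled_forests (A - {a}).
      (\<lambda>t. (root t, fset (children t))) ((\<lambda>(a, F). Node a (Abs_fset F)) x) = x"
    by auto
  show "\<forall>t\<in>labeled_trees A. (\<lambda>(a, F). Node a (Abs_fset F)) (root t, fset (children t)) = t"
    by (simp add: fset_inverse)
  show "(\<lambda>(a, F). Node a (Abs_fset F)) ` (SIGMA a:A. labeled_forests (A - {a})) \<subseteq> labeled_trees A"
  proof clarify
    fix a F assume a: "a \<in> A" and F: "F \<in> labeled_forests (A - {a})"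
    then have V: "(\<Union>t\<in>F. verts t) = A - {a}"
      by (simp add: labeled_forests_def)
    show "Node a (Abs_fset F) \<in> labeled_trees A"
      using a F by (auto simp: labeled_trees_def labeled_tree_Node_iff inv[OF F] V)
  qed
  show "(\<lambda>t. (root t, fset (children t))) ` labeled_trees A \<subseteq> (SIGMA a:A. labeled_forests (A - {a}))"
  proof clarify
    fix t assume t: "t \<in> labeled_trees A"
    obtain a ts where eq: "t = Node a ts" by (cases t)
    have V: "insert a (\<Union>t\<in>fset ts. verts t) = A"
      using t by (simp add: labeled_trees_def eq)
    have l: "fset ts \<in> labeled_forests (\<Union>t\<in>fset ts. verts t)" "a \<notin> (\<Union>t\<in>fset ts. verts t)"
      using t by (simp_all only: labeled_trees_def eq labeled_tree_Node_iff mem_Collect_eq simp_thms)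
    have "(\<Union>t\<in>fset ts. verts t) = A - {a}" using V l(2) by blast
    with l(1) V show "root t \<in> A \<and> fset (children t) \<in> labeled_forests (A - {root t})"
      by (auto simp: eq)
  qed
qed

text \<open>A fixed label a lies in exactly one tree t of a forest. Singling out this tree splits an
  unordered forest in a unique way; D collects the labels outside t.\<close>

lemma bij_betw_labeled_forests:
  assumes a: "a \<in> A"
  shows "bij_betw (\<lambda>(D, t, F). insert t F)
    (SIGMA D:Pow (A - {a}). labeled_trees (A - D) \<times> labeled_forests D) (labeled_forests A)"
  unfolding bij_betw_def
proof
  let ?S = "SIGMA D:Pow (A - {a}). labeled_trees (A - D) \<times> labeled_forests D"
  \<comment> \<open>The triple can be recovered from \<open>insert t F\<close>: F consists of the
    trees that miss a, D is the vertex set of F, and t is the tree left over. Injectivity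
    follows.\<close>
  have notin: "a \<in> verts t" "t \<notin> F" "F = {s \<in> insert t F. a \<notin> verts s}" "D = (\<Union>s\<in>F. verts s)"
    if "D \<in> Pow (A - {a})" "t \<in> labeled_trees (A - D)" "F \<in> labeled_forests D" for D t F
  proof -
    have V: "verts t = A - D" "(\<Union>s\<in>F. verts s) = D" and "a \<notin> D"
      using that by (auto simp: labeled_trees_def labeled_forests_def)
    then show t: "a \<in> verts t" and "D = (\<Union>s\<in>F. verts s)" using a by auto
    have "a \<notin> verts s" if "s \<in> F" for s using that V(2) \<open>a \<notin> D\<close> by blast
    with t show "t \<notin> F" and "F = {s \<in> insert t F. a \<notin> verts s}" by blast+
  qed
  show "inj_on (\<lambda>(D, t, F). insert t F) ?S"
  proof (rule inj_onI)
    fix x y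
    assume "x \<in> ?S" "y \<in> ?S" "(\<lambda>(D, t, F). insert t F) x = (\<lambda>(D, t, F). insert t F) y"
    then obtain D t F D' t' F' where xy: "x = (D, t, F)" "y = (D', t', F')"
      and 1: "D \<subseteq> A - {a}" "t \<in> labeled_trees (A - D)" "F \<in> labeled_forests D"
      and 2: "D' \<subseteq> A - {a}" "t' \<in> labeled_trees (A - D')" "F' \<in> labeled_forests D'"
      and eq: "insert t F = insert t' F'"
      by auto
    note n1 = notin[OF _ 1(2,3)] and n2 = notin[OF _ 2(2,3)]
    have F: "F = F'" using n1(3) n2(3) 1(1) 2(1) eq by simp
    moreover have "D = D'" using n1(4) n2(4) 1(1) 2(1) F by simp
    moreover have "t = t'" using n1(2) n2(2) 1(1) 2(1) F eq by blast
    ultimately show "x = y" by (simp add: xy)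
  qed
  show "(\<lambda>(D, t, F). insert t F) ` ?S = labeled_forests A"
  proof (intro equalityI subsetI)
    fix G assume "G \<in> (\<lambda>(D, t, F). insert t F) ` ?S"
    then obtain D t F where G: "G = insert t F" and D: "D \<subseteq> A - {a}"
      and t: "t \<in> labeled_trees (A - D)" and F: "F \<in> labeled_forests D"
      by auto
    have "t \<notin> F" using notin(2)[OF _ t F] D by simp
    then show "G \<in> labeled_forests A"
      using D t F unfolding G
      by (auto simp: labeled_trees_def labeled_forests_def disjoint_family_on_insert)
  next
    fix G assume G: "G \<in> labeled_forests A"
    then obtain t where t: "t \<in> G" "a \<in> verts t"
      using a by (auto simp: labeled_forests_def)
    \<comment> \<open>For surjectivity, the tree containing a is removed from G, and D is what the
      other trees cover.\<close>
    define F where "F = G - {t}"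
    define D where "D = (\<Union>s\<in>F. verts s)"
    have ins: "G = insert t F" "t \<notin> F" using t by (auto simp: F_def)
    have disj: "disjoint_family_on verts F" "verts t \<inter> D = {}"
      using G by (auto simp: ins(1) disjoint_family_on_insert[OF ins(2)] labeled_forests_def D_def)
    have un: "A = verts t \<union> D" using G by (auto simp: ins(1) labeled_forests_def D_def)
    have "F \<in> labeled_forests D" "t \<in> labeled_trees (A - D)" "D \<subseteq> A - {a}"
      using G disj un t(2) by (auto simp: ins(1) labeled_forests_def labeled_trees_def D_def)
    then show "G \<in> (\<lambda>(D, t, F). insert t F) ` ?S"
      using ins(1) by (auto intro!: image_eqI[of _ _ "(D, t, F)"])
  qed
qed

section \<open>Recursions for the total weight of trees and forests\<close>

definition forest_weight :: "(nat \<Rightarrow> 'b::comm_semiring_1) \<Rightarrow> 'a rtree set \<Rightarrow> 'b" where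
  "forest_weight w F = (\<Prod>h \<in># hook_lengths F. w h)"

text \<open>The root of every tree on A has hook length \<open>card A\<close>, so its weight is a
  common factor. The remaining hook lengths are those of the forest left after removing the
  root.\<close>

lemma sum_labeled_trees:
  assumes fin: "finite A"
  shows "(\<Sum>t\<in>labeled_trees A. forest_weight w {t}) =
    w (card A) * (\<Sum>a\<in>A. \<Sum>F\<in>labeled_forests (A - {a}). forest_weight w F)"
proof -
  have wt: "forest_weight w {Node a (Abs_fset F)} = w (card A) * forest_weight w F"
    if "a \<in> A" "F \<in> labeled_forests (A - {a})" for a F
  proof -
    have inv: "fset (Abs_fset F) = F"
      using finite_labeled_forest[OF _ that(2)] fin by (simp add: Abs_fset_inverse)
    have V: "(\<Union>t\<in>F. verts t) = A - {a}"
      using that(2) by (simp add: labeled_forests_def)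
    have "insert a A = A" using that(1) by blast
    then show ?thesis
      using hook_lengths_Node[of "Abs_fset F" a] fin by (simp add: inv V forest_weight_def)
  qed
  have "(\<Sum>t\<in>labeled_trees A. forest_weight w {t}) =
      (\<Sum>(a, F)\<in>(SIGMA a:A. labeled_forests (A - {a})). forest_weight w {Node a (Abs_fset F)})"
    by (subst sum.reindex_bij_betw[OF bij_betw_labeled_trees[OF fin], symmetric])
       (simp add: case_prod_unfold)
  also have "\<dots> = (\<Sum>a\<in>A. \<Sum>F\<in>labeled_forests (A - {a}). w (card A) * forest_weight w F)"
    using fin by (subst sum.Sigma[symmetric]) (auto intro!: sum.cong finite_labeled_forests simp: wt)
  finally show ?thesis
    by (simp add: sum_distrib_left)
qed

lemma finite_labeled_trees:
  assumes "finite A"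
  shows "finite (labeled_trees A)"
proof -
  have "finite (SIGMA a:A. labeled_forests (A - {a}))"
    using assms by (auto intro: finite_labeled_forests)
  then show ?thesis
    using bij_betw_finite[OF bij_betw_labeled_trees[OF assms]] by simp
qed

text \<open>The tree containing a and the rest of the forest have disjoint vertex sets, so the
  weight is multiplicative, and for each D the sum over pairs factors.\<close>

lemma sum_labeled_forests:
  assumes fin: "finite A" and a: "a \<in> A"
  shows "(\<Sum>F\<in>labeled_forests A. forest_weight w F) =
    (\<Sum>D\<in>Pow (A - {a}). (\<Sum>t\<in>labeled_trees (A - D). forest_weight w {t}) *
       (\<Sum>F\<in>labeled_forests D. forest_weight w F))"
proof -
  have wt: "forest_weight w (insert t F) = forest_weight w {t} * forest_weight w F"
    if "D \<subseteq> A - {a}" "t \<in> labeled_trees (A - D)" "F \<in> labeled_forests D" for D t F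
  proof -
    have V: "verts t = A - D" "(\<Union>s\<in>F. verts s) = D"
      using that(2,3) by (auto simp: labeled_trees_def labeled_forests_def)
    have "hook_lengths (insert t F) = hook_lengths {t} + hook_lengths F"
      using hook_lengths_Un[of "{t}" F] V fin that(1) by (auto intro: finite_subset)
    then show ?thesis by (simp add: forest_weight_def)
  qed
  have finD: "finite D" if "D \<subseteq> A - {a}" for D
    using that fin by (meson finite_Diff finite_subset)
  let ?S = "SIGMA D:Pow (A - {a}). labeled_trees (A - D) \<times> labeled_forests D"
  have "(\<Sum>F\<in>labeled_forests A. forest_weight w F) = (\<Sum>(D, t, F)\<in>?S. forest_weight w (insert t F))"
    by (subst sum.reindex_bij_betw[OF bij_betw_labeled_forests[OF a], symmetric])
       (simp add: case_prod_unfold)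
  also have "\<dots> = (\<Sum>D\<in>Pow (A - {a}). \<Sum>(t, F)\<in>labeled_trees (A - D) \<times> labeled_forests D.
      forest_weight w {t} * forest_weight w F)"
    using fin finD by (subst sum.Sigma[symmetric])
      (auto intro!: sum.cong finite_labeled_forests finite_labeled_trees simp: wt)
  finally show ?thesis
    by (simp add: sum_product sum.cartesian_product)
qed

section \<open>Evaluation of the total weight as a rising factorial\<close>

lemma sum_Pow_card:
  assumes "finite A"
  shows "(\<Sum>D\<in>Pow A. f (card D)) = (\<Sum>k\<le>card A. of_nat (card A choose k) * (f k :: 'b::comm_semiring_1))"
proof -
  have "(\<Sum>D\<in>Pow A. f (card D)) = (\<Sum>k\<le>card A. \<Sum>D\<in>{D \<in> Pow A. card D = k}. f (card D))"
    using assms by (intro sum.group[symmetric]) (auto simp: card_mono)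
  also have "\<dots> = (\<Sum>k\<le>card A. of_nat (card A choose k) * f k)"
    using assms by (intro sum.cong refl) (simp add: n_subsets)
  finally show ?thesis .
qed

text \<open>The condition on w is free of denominators, so the induction runs in any commutative
  ring. In it, h counts the choices of a root, \<open>pochhammer z (h - 1)\<close> is the total
  weight of the forests below that root, and \<open>pochhammer 1 (h - 1)\<close> is (h-1)!.\<close>

lemma sum_forest_weight:
  fixes w :: "nat \<Rightarrow> 'b::comm_ring_1"
  assumes w: "\<And>h. h \<ge> 1 \<Longrightarrow> w h * (of_nat h * pochhammer z (h - 1)) = z * pochhammer 1 (h - 1)"
    and fin: "finite A"
  shows "(\<Sum>F\<in>labeled_forests A. forest_weight w F) = pochhammer z (card A)"
  using fin
proof (induction A rule: finite_psubset_induct)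
  case (psubset A)
  show ?case
  proof (cases "A = {}")
    case True
    \<comment> \<open>Every tree has a root, so only the empty forest covers no labels; its weight
      is the empty product.\<close>
    then have "labeled_forests A = {{}}"
      using root_in_verts by (fastforce simp: labeled_forests_def disjoint_family_on_def)
    then show ?thesis
      by (simp add: True forest_weight_def hook_lengths_def)
  next
    case False
    then obtain a where a: "a \<in> A" by blast
    define m where "m = card (A - {a})"
    have cardA: "card A = Suc m"
      using a psubset.hyps unfolding m_def by (metis card_Suc_Diff1)
    \<comment> \<open>D may be empty, in which case the trees span all of A. The induction
      hypothesis still suffices, because it is applied only after a root b has been removed.\<close>
    have trees: "(\<Sum>t\<in>labeled_trees (A - D). forest_weight w {t}) = z * pochhammer 1 (m - card D)"
      if D: "D \<subseteq> A - {a}" for D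
    proof -
      have "finite D" using D psubset.hyps by (meson finite_Diff finite_subset)
      moreover have "card D \<le> m"
        using D psubset.hyps by (simp add: m_def card_mono)
      ultimately have card: "card (A - D) = Suc (m - card D)"
        using D cardA by (subst card_Diff_subset) auto
      have "(\<Sum>F\<in>labeled_forests (A - D - {b}). forest_weight w F) = pochhammer z (m - card D)"
        if "b \<in> A - D" for b
      proof -
        have "card (A - D - {b}) = m - card D"
          using that card psubset.hyps by simp
        moreover have "A - D - {b} \<subset> A" using that by blast
        ultimately show ?thesis using psubset.IH by simp
      qed
      then have "(\<Sum>t\<in>labeled_trees (A - D). forest_weight w {t}) =
          w (card (A - D)) * (of_nat (card (A - D)) * pochhammer z (card (A - D) - 1))"
        using psubset.hyps by (simp add: sum_labeled_trees card)
      also have "\<dots> = z * pochhammer 1 (m - card D)"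
        using w[of "card (A - D)"] by (simp add: card)
      finally show ?thesis .
    qed
    have "(\<Sum>F\<in>labeled_forests A. forest_weight w F) =
        (\<Sum>D\<in>Pow (A - {a}). z * pochhammer 1 (m - card D) * pochhammer z (card D))"
      unfolding sum_labeled_forests[OF psubset.hyps a]
    proof (intro sum.cong refl)
      fix D assume "D \<in> Pow (A - {a})"
      then have D: "D \<subseteq> A - {a}" "D \<subset> A" using a by auto
      show "(\<Sum>t\<in>labeled_trees (A - D). forest_weight w {t}) *
          (\<Sum>F\<in>labeled_forests D. forest_weight w F) = z * pochhammer 1 (m - card D) * pochhammer z (card D)"
        by (simp only: trees[OF D(1)] psubset.IH[OF D(2)])
    qed
    also have "\<dots> = (\<Sum>k\<le>m. of_nat (m choose k) * (z * pochhammer 1 (m - k) * pochhammer z k))"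
      unfolding m_def using psubset.hyps by (intro sum_Pow_card) simp
    also have "\<dots> = z * (\<Sum>k\<le>m. of_nat (m choose k) * pochhammer z k * pochhammer 1 (m - k))"
      by (simp add: sum_distrib_left mult_ac)
    \<comment> \<open>Vandermonde's identity for the rising factorials of z and 1. The outer z then
      becomes the first factor of the rising factorial of z.\<close>
    also have "\<dots> = z * pochhammer (z + 1) m"
      by (simp add: pochhammer_binomial_sum)
    also have "\<dots> = pochhammer z (card A)"
      by (simp add: cardA pochhammer_rec)
    finally show ?thesis .
  qed
qed

section \<open>From falling to rising factorials, and the identity in the field of rational
  functions\<close>

lemma falling_fact_eq_pochhammer:
  fixes z :: "'a::field"
  assumes "z \<noteq> 0" "h \<ge> 1"
  shows "z * falling_fact (of_nat h - 2 + z) (int h - 2) = pochhammer z (h - 1)"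
proof (cases "h = 1")
  case True
  \<comment> \<open>The index is -1 here, so the convention gives 1/z, and the product with z is the
    empty rising factorial.\<close>
  then show ?thesis using assms by (simp add: falling_fact_def)
next
  case False
  then obtain k where k: "h = Suc (Suc k)"
    using assms(2) by (metis One_nat_def Suc_le_D not_less_eq_eq le_zero_eq not0_implies_Suc)
  \<comment> \<open>With h = k + 2 the factors run from z + k down to z + 1. The extra z in the
    lemma supplies the lowest factor.\<close>
  have "(\<Prod>i<k. of_nat h - 2 + z - of_nat i) = pochhammer (z + 1) k"
    unfolding pochhammer_prod_rev
    by (rule prod.reindex_bij_witness[of _ "\<lambda>i. i - 1" Suc])
       (auto simp: k of_nat_diff algebra_simps)
  then show ?thesis
    by (simp add: k falling_fact_def pochhammer_rec)
qed

text \<open>This is a polynomial of degree 1. Consequently no rising factorial of the indeterminate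
  vanishes, and the denominators of the weights are nonzero.\<close>

lemma ratfun_z_plus_of_nat_neq_0: "ratfun_z + of_nat n \<noteq> 0"
proof -
  have "ratfun_z + of_nat n = Fract [:of_nat n, 1:] 1"
    by (simp add: ratfun_z_def of_nat_fract of_nat_poly)
  also have "\<dots> \<noteq> 0"
    by (simp add: Zero_fract_def eq_fract)
  finally show ?thesis .
qed

lemma of_nat_ratfun_neq_0: "n > 0 \<Longrightarrow> (of_nat n :: rat poly fract) \<noteq> 0"
  by (simp add: of_nat_fract Zero_fract_def eq_fract)

theorem theorem4p8:
  fixes n :: nat and z :: "rat poly fract"
  assumes "n \<ge> 1"
  defines "z \<equiv> ratfun_z"
  shows "(\<Sum>F \<in> labeled_forests {1..n}. \<Prod>h \<in># hook_lengths F.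
            of_nat (fact (h - 1)) / (of_nat h * falling_fact (of_nat h - 2 + z) (int h - 2)))
         = z * falling_fact (of_nat n + z - 1) (int n - 1)"
proof -
  define w where
    "w h = of_nat (fact (h - 1)) / (of_nat h * falling_fact (of_nat h - 2 + z) (int h - 2))" for h
  have z: "z \<noteq> 0"
    using ratfun_z_plus_of_nat_neq_0[of 0] by (simp add: z_def)
  have "pochhammer z k \<noteq> 0" for k
    using ratfun_z_plus_of_nat_neq_0 by (simp add: pochhammer_prod z_def)
  then have "w h * (of_nat h * pochhammer z (h - 1)) = z * of_nat (fact (h - 1))" if "h \<ge> 1" for h
  proof -
    \<comment> \<open>Since z * x is a nonzero rising factorial, x is nonzero; h and x then cancel
      against the denominator of \<open>w h\<close>, leaving the factor z.\<close>
    define x where "x = falling_fact (of_nat h - 2 + z) (int h - 2)"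
    have x: "z * x = pochhammer z (h - 1)"
      unfolding x_def by (rule falling_fact_eq_pochhammer[OF z that])
    with \<open>pochhammer z (h - 1) \<noteq> 0\<close> have "x \<noteq> 0" by auto
    moreover have "(of_nat h :: rat poly fract) \<noteq> 0"
      using that by (simp add: of_nat_ratfun_neq_0)
    ultimately show ?thesis
      unfolding w_def x[symmetric] x_def[symmetric] by (simp add: field_simps)
  qed
  moreover have "(of_nat (fact k) :: rat poly fract) = pochhammer 1 k" for k
    using pochhammer_of_nat[of 1 k, where ?'a = "rat poly fract"] by (simp add: pochhammer_fact)
  ultimately have "(\<Sum>F\<in>labeled_forests {1..n}. forest_weight w F) = pochhammer z n"
    by (subst sum_forest_weight) auto
  \<comment> \<open>The right-hand side is the conversion formula at h = n + 1, where h - 2 becomes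
    n - 1.\<close>
  also have "\<dots> = z * falling_fact (of_nat n + z - 1) (int n - 1)"
    using falling_fact_eq_pochhammer[OF z, of "Suc n"] by (simp add: algebra_simps)
  finally show ?thesis
    by (simp add: forest_weight_def w_def)
qed

end
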